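(* Let $(S_O,P_O)$ be a deductive source with irredundant core $A=\mathrm{Atom}(S_O)$ and reconstruction alphabet $\hat S_O$. Assume $A\neq\varnothing$, $A\subseteq\hat S_O$, and that for all distinct $a_1,a_2\in A$ one has $R_{\mathrm{Cn}}(a_1)\cap R_{\mathrm{Cn}}(a_2)=\varnothing$. Then $$R_{\mathrm{sem}}(0;d_{\mathrm{Cn}},P_O)=P_A\,H(\pi_A),$$ with the convention that the right-hand side is $0$ when $P_A=0$.
   Context: Setting. $\mathbb{S}_O$ is a finite set of statements with a fixed proof system with decidable derivability; $\mathrm{Cn}(\Gamma)\subseteq\mathbb{S}_O$ denotes the set of statements derivable from $\Gamma\subseteq\mathbb{S}_O$. $\mathrm{Cn}$ is reflexive ($\Gamma\subseteq\mathrm{Cn}(\Gamma)$), monotone ($\Gamma\subseteq\Gamma'\Rightarrow\mathrm{Cn}(\Gamma)\subseteq\mathrm{Cn}(\Gamma')$) and idempotent. $S_O\subseteq\mathbb{S}_O$ is a finite knowledge base with a fixed linear (canonical) order, $\hat S_O\subseteq\mathbb{S}_O$ is a nonempty finite reconstruction alphabet, and a deductive source is a pair $(S_O,P_O)$ with $P_O$ a probability distribution on $S_O$. Core. $\mathrm{Atom}(S_O)$ is the output of the deletion procedure: start with $B=S_O$; scan the elements $s$ of $S_O$ in the canonical order; whenever the scanned $s$ satisfies $s\in\mathrm{Cn}(B\setminus\{s\})$ for the current $B$, remove $s$ from $B$; the final $B$ is $\mathrm{Atom}(S_O)$. Put $A=\mathrm{Atom}(S_O)$, $P_A=P_O(A)$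 and, if $P_A>0$, $\pi_A(a)=P_O(a)/P_A$ for $a\in A$. Closure distortion. For $s\in S_O$, $\hat s\in\mathbb{S}_O$, let $C_s=\mathrm{Cn}(S_O)$ and $C_{\hat s}=\mathrm{Cn}((S_O\setminus\{s\})\cup\{\hat s\})$; then $d_{\mathrm{Cn}}(s,\hat s)=d_{\mathrm{Cn}}(s,\hat s\mid S_O)=1-|C_s\cap C_{\hat s}|/|C_s\cup C_{\hat s}|$, with $0/0$ giving distortion $0$. For $s\in S_O$, $R_{\mathrm{Cn}}(s)=\{\hat s\in\hat S_O: d_{\mathrm{Cn}}(s,\hat s\mid S_O)=0\}$. Rate–distortion function. $R_{\mathrm{sem}}(D;d_{\mathrm{Cn}},P_O)$ is the minimum of the mutual information $I(\mathsf S_o;\hat{\mathsf S}_o)$ over all test channels $P_{\hat S\mid S}$ from $S_O$ to $\hat S_O$ with $\mathbb{E}[d_{\mathrm{Cn}}(\mathsf S_o,\hat{\mathsf S}_o)]\le D$, where $\mathsf S_o\sim P_O$ and $\hat{\mathsf S}_o\sim P_{\hat S\mid S}(\cdot\mid\mathsf S_o)$ (value $+\infty$ if no such channel exists). $H$ is Shannon entropy. *)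

theory Defs
  imports "HOL-Probability.Probability"
begin

text \<open>The finite universe of statements is a type of class \<open>finite\<close>. The proof system enters only
  through its consequence operator \<open>Cn\<close>; every closure operator on a finite set is the derivability
  operator of some (decidable) proof system, so nothing is lost.\<close>

locale consequence_operator =
  fixes Cn :: "'a::finite set \<Rightarrow> 'a set"
  assumes Cn_refl: "\<Gamma> \<subseteq> Cn \<Gamma>"
    and Cn_mono: "\<Gamma> \<subseteq> \<Gamma>' \<Longrightarrow> Cn \<Gamma> \<subseteq> Cn \<Gamma>'"
    and Cn_idem: "Cn (Cn \<Gamma>) = Cn \<Gamma>"

text \<open>A knowledge base together with its canonical order is a duplicate-free list.\<close>

definition deductive_source :: "'a::finite list \<Rightarrow> 'a pmf \<Rightarrow> bool" where
  "deductive_source S P \<longleftrightarrow> distinct S \<and> set_pmf P \<subseteq> set S"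

definition Atom :: "('a::finite set \<Rightarrow> 'a set) \<Rightarrow> 'a list \<Rightarrow> 'a set" where
  "Atom Cn S = fold (\<lambda>s B. if s \<in> Cn (B - {s}) then B - {s} else B) S (set S)"

text \<open>The case split is needed for the convention that \<open>0/0\<close> gives distortion \<open>0\<close>: with
  \<open>x / 0 = 0\<close> the formula alone would give \<open>1\<close>.\<close>

definition d_Cn :: "('a::finite set \<Rightarrow> 'a set) \<Rightarrow> 'a set \<Rightarrow> 'a \<Rightarrow> 'a \<Rightarrow> real" where
  "d_Cn Cn S s s' =
     (let C = Cn S; C' = Cn ((S - {s}) \<union> {s'})
      in if C \<union> C' = {} then 0 else 1 - real (card (C \<inter> C')) / real (card (C \<union> C')))"

definition R_Cn :: "('a::finite set \<Rightarrow> 'a set) \<Rightarrow> 'a set \<Rightarrow> 'a set \<Rightarrow> 'a \<Rightarrow> 'a set" where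
  "R_Cn Cn S S' s = {s' \<in> S'. d_Cn Cn S s s' = 0}"

text \<open>A test channel is a Markov kernel; its values outside the source alphabet are irrelevant, as
  the source distribution is supported there.\<close>

definition test_channels :: "'a set \<Rightarrow> 'b set \<Rightarrow> ('a \<Rightarrow> 'b pmf) set" where
  "test_channels S S' = {W. \<forall>s\<in>S. set_pmf (W s) \<subseteq> S'}"

definition joint_pmf :: "'a pmf \<Rightarrow> ('a \<Rightarrow> 'b pmf) \<Rightarrow> ('a \<times> 'b) pmf" where
  "joint_pmf P W = bind_pmf P (\<lambda>s. map_pmf (Pair s) (W s))"

definition channel_information :: "real \<Rightarrow> 'a pmf \<Rightarrow> ('a \<Rightarrow> 'b pmf) \<Rightarrow> real" where
  "channel_information b P W =
     prob_space.mutual_information (measure_pmf (joint_pmf P W)) b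
       (count_space UNIV) (count_space UNIV) fst snd"

definition shannon_entropy :: "real \<Rightarrow> 'a pmf \<Rightarrow> real" where
  "shannon_entropy b p = prob_space.entropy (measure_pmf p) b (count_space UNIV) (\<lambda>x. x)"

definition feasible_channels ::
    "('a \<Rightarrow> 'b \<Rightarrow> real) \<Rightarrow> 'a pmf \<Rightarrow> 'a set \<Rightarrow> 'b set \<Rightarrow> real \<Rightarrow> ('a \<Rightarrow> 'b pmf) set" where
  "feasible_channels d P S S' D =
     {W \<in> test_channels S S'.
        measure_pmf.expectation (joint_pmf P W) (\<lambda>(s, s'). d s s') \<le> D}"

text \<open>\<open>LEAST\<close> rather than an infimum: the value is only determined if the minimum is attained.
  The parameter \<open>b\<close> is the base of the logarithm.\<close>

definition R_sem ::
    "real \<Rightarrow> ('a \<Rightarrow> 'b \<Rightarrow> real) \<Rightarrow> 'a pmf \<Rightarrow> 'a set \<Rightarrow> 'b set \<Rightarrow> real \<Rightarrow> ereal" where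
  "R_sem b d P S S' D =
     (if feasible_channels d P S S' D = {} then \<infinity>
      else ereal (LEAST r. r \<in> channel_information b P ` feasible_channels d P S S' D))"

end

theory Submission
  imports Defs
begin

text \<open>At distortion \<open>0\<close> a channel sends each core element \<open>a\<close> into its own cell \<open>R(a)\<close>, the
  cells being disjoint, whereas a redundant statement may go to any core element. Gibbs' inequality
  against the weight \<open>g(a,y) = 1[y \<in> R(a)] / \<pi>(a)\<close> on the core and \<open>g = 1\<close> off it bounds the
  information from below. Equality holds for the channel that fixes the core and
  sends every redundant statement to an independent sample of \<open>\<pi>\<close>, since then the output law is
  \<open>\<pi>\<close> and the information density is exactly \<open>g\<close>.\<close>

section \<open>Mutual information and entropy as finite sums\<close>

lemma pmf_joint_pmf: "pmf (joint_pmf P W) (s, y) = pmf P s * pmf (W s) y"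
  for P :: "'a::finite pmf" and W :: "'a \<Rightarrow> 'b pmf"
proof -
  have "pmf (map_pmf (Pair t) (W t)) (s, y) = (if t = s then pmf (W s) y else 0)" for t
  proof (cases "t = s")
    case True
    then show ?thesis
      using pmf_map_inj'[of "Pair s" "W s" y] by (simp add: inj_on_def)
  next
    case False
    then show ?thesis by (auto intro!: pmf_map_outside)
  qed
  note this[simp]
  show ?thesis
    by (simp add: joint_pmf_def pmf_bind integral_measure_pmf[of UNIV] if_distrib cong: if_cong)
qed

lemma map_fst_joint_pmf: "map_pmf fst (joint_pmf P W) = P"
  by (simp add: joint_pmf_def map_bind_pmf pmf.map_comp o_def bind_return_pmf')

lemma map_snd_joint_pmf: "map_pmf snd (joint_pmf P W) = bind_pmf P W"
  by (simp add: joint_pmf_def map_bind_pmf pmf.map_comp o_def)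

lemma simple_distributed_measure_pmf:
  fixes J :: "'a pmf" and X :: "'a \<Rightarrow> 'b::finite"
  assumes "surj X"
  shows "simple_distributed (measure_pmf J) X (pmf (map_pmf X J))"
  using assms
  by (intro measure_pmf.simple_distributedI) (auto simp: simple_function_def pmf_map)

lemma channel_information_eq_sum:
  fixes P :: "'a::finite pmf" and W :: "'a \<Rightarrow> 'b::finite pmf"
  assumes "b > 1"
  shows "channel_information b P W =
    (\<Sum>s\<in>UNIV. \<Sum>y\<in>UNIV. pmf P s * pmf (W s) y * log b (pmf (W s) y / pmf (bind_pmf P W) y))"
proof -
  let ?J = "joint_pmf P W"
  interpret information_space "measure_pmf ?J" b
    by unfold_locales (use assms in auto)
  have sur: "surj (fst :: 'a \<times> 'b \<Rightarrow> 'a)" "surj (snd :: 'a \<times> 'b \<Rightarrow> 'b)" by auto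
  have X: "simple_distributed ?J fst (pmf P)"
    using simple_distributed_measure_pmf[OF sur(1), of ?J] by (simp add: map_fst_joint_pmf)
  have Y: "simple_distributed ?J snd (pmf (bind_pmf P W))"
    using simple_distributed_measure_pmf[OF sur(2), of ?J] by (simp add: map_snd_joint_pmf)
  have XY: "simple_distributed ?J (\<lambda>x. (fst x, snd x)) (pmf ?J)"
    using simple_distributed_measure_pmf[of "\<lambda>x. x" ?J] by simp
  have "channel_information b P W =
      (\<Sum>(s, y)\<in>UNIV. pmf ?J (s, y) * log b (pmf ?J (s, y) / (pmf P s * pmf (bind_pmf P W) y)))"
    unfolding channel_information_def
    using mutual_information_simple_distributed[OF X Y XY] by simp
  also have "\<dots> = (\<Sum>s\<in>UNIV. \<Sum>y\<in>UNIV. pmf ?J (s, y) *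
      log b (pmf ?J (s, y) / (pmf P s * pmf (bind_pmf P W) y)))"
    by (simp add: sum.cartesian_product)
  also have "\<dots> = (\<Sum>s\<in>UNIV. \<Sum>y\<in>UNIV.
      pmf P s * pmf (W s) y * log b (pmf (W s) y / pmf (bind_pmf P W) y))"
    \<comment> \<open>Where \<open>pmf P s = 0\<close>, both terms vanish by their leading factor;
      elsewhere \<open>pmf P s\<close> cancels inside the logarithm.\<close>
    by (intro sum.cong refl) (auto simp: pmf_joint_pmf)
  finally show ?thesis .
qed

lemma shannon_entropy_eq_sum:
  fixes p :: "'a::finite pmf"
  assumes "b > 1"
  shows "shannon_entropy b p = - (\<Sum>x\<in>UNIV. pmf p x * log b (pmf p x))"
proof -
  interpret information_space "measure_pmf p" b
    by unfold_locales (use assms in auto)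
  show ?thesis
    unfolding shannon_entropy_def
    using entropy_simple_distributed[OF simple_distributed_measure_pmf[of "\<lambda>x. x" p]] by simp
qed

section \<open>Gibbs' inequality as a lower bound on information\<close>

lemma pmf_bind_pos:
  assumes "s \<in> set_pmf P" "y \<in> set_pmf (W s)"
  shows "pmf (bind_pmf P W) y > 0"
  using assms by (auto simp: pmf_positive_iff)

text \<open>The difference of the two sides is the relative entropy of the joint law to the weight
  in \<open>le_1\<close>, which is nonnegative since that weight has total mass at most 1. So
  \<open>g\<close> acts as a trial information density, free to be chosen in each
  application.\<close>

lemma channel_information_ge:
  fixes P :: "'a::finite pmf" and W :: "'a \<Rightarrow> 'b::finite pmf" and g :: "'a \<Rightarrow> 'b \<Rightarrow> real"
  assumes b: "b > 1"
    and nonneg: "\<And>s y. g s y \<ge> 0"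
    and pos: "\<And>s y. s \<in> set_pmf P \<Longrightarrow> y \<in> set_pmf (W s) \<Longrightarrow> g s y > 0"
    and le_1: "(\<Sum>s\<in>UNIV. \<Sum>y\<in>UNIV. pmf P s * pmf (bind_pmf P W) y * g s y) \<le> 1"
  shows "(\<Sum>s\<in>UNIV. \<Sum>y\<in>UNIV. pmf P s * pmf (W s) y * log b (g s y)) \<le> channel_information b P W"
proof -
  define q where "q = pmf (bind_pmf P W)"
  have lnb: "ln b > 0" using b by simp
  \<comment> \<open>The second summand is the linear correction left by
    \<open>ln x \<le> x - 1\<close>. Summed over all pairs it becomes 1 minus the mass of the
    weight, divided by \<open>ln b\<close>, hence nonnegative by \<open>le_1\<close>.\<close>
  have termwise: "pmf P s * pmf (W s) y * log b (g s y)
      + (pmf P s * pmf (W s) y - pmf P s * q y * g s y) / ln b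
      \<le> pmf P s * pmf (W s) y * log b (pmf (W s) y / q y)" for s y
  proof (cases "s \<in> set_pmf P \<and> y \<in> set_pmf (W s)")
    case False
    \<comment> \<open>Off the support both logarithmic terms carry a zero factor, and the correction
      is nonpositive because \<open>g\<close> is nonnegative.\<close>
    then have *: "pmf P s * pmf (W s) y = 0" by (auto simp: set_pmf_iff)
    show ?thesis unfolding * using nonneg[of s y] lnb by (simp add: q_def)
  next
    case True
    define w where "w = pmf (W s) y"
    have p: "pmf P s > 0" and w: "w > 0" and q: "q y > 0" and g: "g s y > 0"
      using True pos pmf_bind_pos[of s P y W] by (auto simp: q_def w_def pmf_positive)
    \<comment> \<open>The argument is the ratio of the weight to the joint mass, with
      \<open>pmf P s\<close> cancelled.\<close>
    have "ln (q y * g s y / w) \<le> q y * g s y / w - 1"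
      using w q g by (intro ln_le_minus_one) simp
    then have "ln (g s y) + (1 - q y * g s y / w) \<le> ln (w / q y)"
      using w q g by (simp add: ln_mult ln_div)
    then have "pmf P s * w * (ln (g s y) + (1 - q y * g s y / w)) \<le> pmf P s * w * ln (w / q y)"
      using p w by (intro mult_left_mono) auto
    moreover have "pmf P s * w * (ln (g s y) + (1 - q y * g s y / w))
        = pmf P s * w * ln (g s y) + (pmf P s * w - pmf P s * q y * g s y)"
      using w by (simp add: field_simps)
    ultimately have "(pmf P s * w * ln (g s y) + (pmf P s * w - pmf P s * q y * g s y)) / ln b
        \<le> pmf P s * w * ln (w / q y) / ln b"
      using lnb by (intro divide_right_mono) auto
    then show ?thesis by (simp add: log_def w_def add_divide_distrib)
  qed
  have total: "(\<Sum>s\<in>UNIV. \<Sum>y\<in>UNIV. pmf P s * pmf (W s) y) = 1"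
    by (simp add: sum_distrib_left[symmetric] sum_pmf_eq_1)
  have "(\<Sum>s\<in>UNIV. \<Sum>y\<in>UNIV. pmf P s * pmf (W s) y * log b (g s y))
      + (1 - (\<Sum>s\<in>UNIV. \<Sum>y\<in>UNIV. pmf P s * q y * g s y)) / ln b
    = (\<Sum>s\<in>UNIV. \<Sum>y\<in>UNIV. pmf P s * pmf (W s) y * log b (g s y)
      + (pmf P s * pmf (W s) y - pmf P s * q y * g s y) / ln b)"
    by (simp add: sum.distrib sum_subtractf sum_divide_distrib[symmetric] total)
  also have "\<dots> \<le> channel_information b P W"
    unfolding channel_information_eq_sum[OF b] q_def[symmetric]
    by (intro sum_mono termwise)
  finally have "(\<Sum>s\<in>UNIV. \<Sum>y\<in>UNIV. pmf P s * pmf (W s) y * log b (g s y))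
      + (1 - (\<Sum>s\<in>UNIV. \<Sum>y\<in>UNIV. pmf P s * q y * g s y)) / ln b \<le> channel_information b P W" .
  moreover have "(1 - (\<Sum>s\<in>UNIV. \<Sum>y\<in>UNIV. pmf P s * q y * g s y)) / ln b \<ge> 0"
    using le_1 lnb by (simp add: q_def)
  ultimately show ?thesis by linarith
qed

text \<open>With trial density 1 the weight is the product of the marginals, of mass exactly 1, and
  the lower bound is a sum of terms with \<open>log b 1 = 0\<close>.\<close>

lemma channel_information_nonneg:
  fixes P :: "'a::finite pmf" and W :: "'a \<Rightarrow> 'b::finite pmf"
  assumes "b > 1"
  shows "channel_information b P W \<ge> 0"
  using channel_information_ge[OF assms, of "\<lambda>_ _. 1" P W]
  by (simp add: sum_distrib_left[symmetric] sum_pmf_eq_1)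

lemma channel_information_const:
  fixes P :: "'a::finite pmf" and Q :: "'b::finite pmf"
  assumes "b > 1"
  shows "channel_information b P (\<lambda>_. Q) = 0"
proof -
  have "pmf P s * pmf Q y * log b (pmf Q y / pmf (bind_pmf P (\<lambda>_. Q)) y) = 0" for s y
    by (cases "pmf Q y = 0") auto
  then show ?thesis unfolding channel_information_eq_sum[OF assms] by (intro sum.neutral ballI)
qed

section \<open>The lower bound by the core entropy\<close>

lemma prob_mult_entropy_cond_pmf:
  fixes P :: "'a::finite pmf"
  assumes "b > 1" and ne: "set_pmf P \<inter> A \<noteq> {}"
  shows "measure_pmf.prob P A * shannon_entropy b (cond_pmf P A)
    = (\<Sum>a\<in>A. pmf P a * log b (1 / pmf (cond_pmf P A) a))"
proof -
  let ?\<pi> = "cond_pmf P A"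
  have pos: "measure_pmf.prob P A \<noteq> 0"
    using ne by (auto simp: measure_pmf_zero_iff)
  have \<pi>: "pmf ?\<pi> x = (if x \<in> A then pmf P x / measure_pmf.prob P A else 0)" for x
    by (rule pmf_cond[OF ne])
  have "measure_pmf.prob P A * shannon_entropy b ?\<pi>
      = (\<Sum>x\<in>UNIV. - (measure_pmf.prob P A * pmf ?\<pi> x * log b (pmf ?\<pi> x)))"
    by (simp add: shannon_entropy_eq_sum[OF assms(1)] sum_distrib_left sum_negf mult.assoc)
  also have "\<dots> = (\<Sum>a\<in>A. - (measure_pmf.prob P A * pmf ?\<pi> a * log b (pmf ?\<pi> a)))"
    by (rule sum.mono_neutral_right) (auto simp: \<pi>)
  also have "\<dots> = (\<Sum>a\<in>A. pmf P a * log b (1 / pmf ?\<pi> a))"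
  proof (rule sum.cong[OF refl])
    fix a assume "a \<in> A"
    \<comment> \<open>The prefactor undoes the normalization of the conditional law, so the core
      letters are weighted by \<open>P\<close> itself, as in the information sums.\<close>
    then have "measure_pmf.prob P A * pmf ?\<pi> a = pmf P a" using pos by (simp add: \<pi>)
    then show "- (measure_pmf.prob P A * pmf ?\<pi> a * log b (pmf ?\<pi> a))
        = pmf P a * log b (1 / pmf ?\<pi> a)"
      by (simp add: log_def ln_div ln_inverse divide_inverse[of 1])
  qed
  finally show ?thesis .
qed

text \<open>The row of the weight at a core letter \<open>s\<close> has mass at most the mass of
  \<open>A\<close> times the output mass of \<open>R s\<close>. Disjoint cells bound the sum of
  these rows by the mass of \<open>A\<close>; the remaining rows, where the channel is unrestricted,
  supply exactly the mass of the complement. So the total is at most 1 and Gibbs' inequality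
  applies.\<close>

lemma channel_information_ge_core_entropy:
  fixes P :: "'a::finite pmf" and W :: "'a \<Rightarrow> 'b::finite pmf" and R :: "'a \<Rightarrow> 'b set"
  assumes b: "b > 1" and ne: "set_pmf P \<inter> A \<noteq> {}"
    and disj: "disjoint_family_on R A"
    and supp: "\<And>a. a \<in> set_pmf P \<inter> A \<Longrightarrow> set_pmf (W a) \<subseteq> R a"
  shows "measure_pmf.prob P A * shannon_entropy b (cond_pmf P A) \<le> channel_information b P W"
proof -
  define \<pi> where "\<pi> = pmf (cond_pmf P A)"
  define q where "q = bind_pmf P W"
  define g where "g s y = (if s \<in> A then if y \<in> R s then 1 / \<pi> s else 0 else 1)" for s y
  let ?PA = "measure_pmf.prob P A"
  have \<pi>: "\<pi> a = pmf P a / ?PA" if "a \<in> A" for a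
    using that pmf_cond[OF ne] by (simp add: \<pi>_def)
  have PA: "?PA > 0"
    using ne by (auto simp: measure_pmf_zero_iff zero_less_measure_iff)
  have core: "(\<Sum>y\<in>UNIV. pmf P s * pmf q y * g s y) \<le> ?PA * measure_pmf.prob q (R s)"
    if "s \<in> A" for s
  proof -
    have "(\<Sum>y\<in>UNIV. pmf P s * pmf q y * g s y) = (\<Sum>y\<in>R s. pmf P s * pmf q y * g s y)"
      using that by (intro sum.mono_neutral_right) (auto simp: g_def)
    also have "\<dots> = (pmf P s / \<pi> s) * measure_pmf.prob q (R s)"
      using that by (simp add: g_def measure_measure_pmf_finite sum_distrib_left)
    \<comment> \<open>The quotient \<open>pmf P s / \<pi> s\<close> equals \<open>?PA\<close> if
      \<open>pmf P s > 0\<close>. Otherwise it is \<open>0 / 0 = 0\<close>, so only an inequality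
      holds in general.\<close>
    also have "\<dots> \<le> ?PA * measure_pmf.prob q (R s)"
      using that PA by (intro mult_right_mono) (auto simp: \<pi>)
    finally show ?thesis .
  qed
  have off: "(\<Sum>y\<in>UNIV. pmf P s * pmf q y * g s y) = pmf P s" if "s \<notin> A" for s
    using that by (simp add: g_def sum_distrib_left[symmetric] sum_pmf_eq_1)
  \<comment> \<open>Disjointness enters here: the sum is the output mass of the union of the
    cells.\<close>
  have cells: "(\<Sum>s\<in>A. measure_pmf.prob q (R s)) \<le> 1"
    using measure_pmf.finite_measure_finite_Union[of A R q] disj
      measure_pmf.prob_le_1[of q "\<Union> (R ` A)"] by simp
  have "(\<Sum>s\<in>UNIV. \<Sum>y\<in>UNIV. pmf P s * pmf q y * g s y)
      = (\<Sum>s\<in>A. \<Sum>y\<in>UNIV. pmf P s * pmf q y * g s y) + (\<Sum>s\<in>-A. pmf P s)"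
    using sum.subset_diff[of A UNIV "\<lambda>s. \<Sum>y\<in>UNIV. pmf P s * pmf q y * g s y"]
    by (simp add: off Compl_eq_Diff_UNIV add.commute)
  also have "\<dots> \<le> (\<Sum>s\<in>A. ?PA * measure_pmf.prob q (R s)) + (1 - ?PA)"
    using measure_pmf.prob_compl[of A P]
    by (intro add_mono sum_mono core)
       (auto simp: measure_measure_pmf_finite Compl_eq_Diff_UNIV)
  also have "\<dots> \<le> ?PA * 1 + (1 - ?PA)"
    unfolding sum_distrib_left[symmetric] using cells by (intro add_right_mono mult_left_mono) auto
  finally have le_1: "(\<Sum>s\<in>UNIV. \<Sum>y\<in>UNIV. pmf P s * pmf q y * g s y) \<le> 1" by simp
  have "?PA * shannon_entropy b (cond_pmf P A) = (\<Sum>a\<in>A. pmf P a * log b (1 / \<pi> a))"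
    unfolding \<pi>_def by (rule prob_mult_entropy_cond_pmf[OF b ne])
  also have "\<dots> = (\<Sum>s\<in>A. \<Sum>y\<in>UNIV. pmf P s * pmf (W s) y * log b (g s y))"
  proof (rule sum.cong[OF refl])
    fix a assume a: "a \<in> A"
    \<comment> \<open>On the support \<open>y\<close> lies in the cell of \<open>a\<close>, where
      the logarithm does not depend on \<open>y\<close>; the row then sums out to
      \<open>pmf P a\<close> times that constant.\<close>
    have "pmf P a * pmf (W a) y * log b (g a y) = pmf P a * log b (1 / \<pi> a) * pmf (W a) y" for y
      using a supp[of a] by (cases "a \<in> set_pmf P \<and> y \<in> set_pmf (W a)") (auto simp: g_def set_pmf_iff)
    then show "pmf P a * log b (1 / \<pi> a) = (\<Sum>y\<in>UNIV. pmf P a * pmf (W a) y * log b (g a y))"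
      by (simp only: sum_distrib_left[symmetric]) (simp add: sum_pmf_eq_1)
  qed
  also have "\<dots> = (\<Sum>s\<in>UNIV. \<Sum>y\<in>UNIV. pmf P s * pmf (W s) y * log b (g s y))"
    by (rule sum.mono_neutral_left) (auto simp: g_def)
  also have "\<dots> \<le> channel_information b P W"
  proof (rule channel_information_ge[OF b])
    show "g s y \<ge> 0" for s y by (simp add: g_def \<pi>_def)
    show "g s y > 0" if "s \<in> set_pmf P" "y \<in> set_pmf (W s)" for s y
      using that supp[of s] PA by (auto simp: g_def \<pi> pmf_positive)
  qed (use le_1 in \<open>simp add: q_def\<close>)
  finally show ?thesis .
qed

section \<open>The optimal channel\<close>

definition core_channel :: "'a pmf \<Rightarrow> 'a set \<Rightarrow> 'a \<Rightarrow> 'a pmf" where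
  "core_channel P A s = (if s \<in> A then return_pmf s else cond_pmf P A)"

text \<open>The core is passed through unchanged and contributes its mass times the conditional law;
  the remaining mass is resampled from the same law. The two contributions add up to that
  law.\<close>

lemma bind_core_channel:
  fixes P :: "'a::finite pmf"
  assumes ne: "set_pmf P \<inter> A \<noteq> {}"
  shows "bind_pmf P (core_channel P A) = cond_pmf P A"
proof (rule pmf_eqI)
  fix y
  let ?PA = "measure_pmf.prob P A" and ?\<pi> = "pmf (cond_pmf P A) y"
  have PA: "?PA \<noteq> 0"
    using ne by (auto simp: measure_pmf_zero_iff)
  have "pmf (bind_pmf P (core_channel P A)) y
      = (\<Sum>s\<in>UNIV. pmf P s * pmf (core_channel P A s) y)"
    by (simp add: pmf_bind integral_measure_pmf[of UNIV])
  also have "\<dots> = (\<Sum>s\<in>A. pmf P s * pmf (core_channel P A s) y)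
      + (\<Sum>s\<in>-A. pmf P s * pmf (core_channel P A s) y)"
    using sum.subset_diff[of A UNIV "\<lambda>s. pmf P s * pmf (core_channel P A s) y"]
    by (simp add: Compl_eq_Diff_UNIV add.commute)
  also have "(\<Sum>s\<in>A. pmf P s * pmf (core_channel P A s) y) = (\<Sum>s\<in>A. if y = s then pmf P s else 0)"
    by (intro sum.cong refl) (auto simp: core_channel_def indicator_def)
  also have "\<dots> = ?PA * ?\<pi>"
    using PA by (simp add: pmf_cond[OF ne])
  also have "(\<Sum>s\<in>-A. pmf P s * pmf (core_channel P A s) y) = (\<Sum>s\<in>-A. pmf P s) * ?\<pi>"
    by (simp add: core_channel_def sum_distrib_right)
  also have "(\<Sum>s\<in>-A. pmf P s) = 1 - ?PA"
    using measure_pmf.prob_compl[of A P]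
    by (simp add: measure_measure_pmf_finite Compl_eq_Diff_UNIV)
  finally show "pmf (bind_pmf P (core_channel P A)) y = ?\<pi>" by (simp add: algebra_simps)
qed

lemma channel_information_core_channel:
  fixes P :: "'a::finite pmf"
  assumes b: "b > 1" and ne: "set_pmf P \<inter> A \<noteq> {}"
  shows "channel_information b P (core_channel P A)
    = measure_pmf.prob P A * shannon_entropy b (cond_pmf P A)"
proof -
  let ?W = "core_channel P A" and ?\<pi> = "pmf (cond_pmf P A)"
  have "channel_information b P ?W
      = (\<Sum>s\<in>UNIV. \<Sum>y\<in>UNIV. pmf P s * pmf (?W s) y * log b (pmf (?W s) y / ?\<pi> y))"
    by (simp add: channel_information_eq_sum[OF b] bind_core_channel[OF ne])
  also have "\<dots> = (\<Sum>s\<in>A. \<Sum>y\<in>UNIV. pmf P s * pmf (?W s) y * log b (pmf (?W s) y / ?\<pi> y))"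
    \<comment> \<open>Off the core the channel row coincides with the output law, so each term has
      ratio 1 or a zero factor.\<close>
    by (rule sum.mono_neutral_right) (auto simp: core_channel_def intro!: sum.neutral)
  also have "\<dots> = (\<Sum>a\<in>A. pmf P a * log b (1 / ?\<pi> a))"
  proof (rule sum.cong[OF refl])
    fix a assume "a \<in> A"
    then have "(\<Sum>y\<in>UNIV. pmf P a * pmf (?W a) y * log b (pmf (?W a) y / ?\<pi> y))
        = (\<Sum>y\<in>UNIV. if y = a then pmf P a * log b (1 / ?\<pi> a) else 0)"
      by (intro sum.cong refl) (auto simp: core_channel_def)
    then show "(\<Sum>y\<in>UNIV. pmf P a * pmf (?W a) y * log b (pmf (?W a) y / ?\<pi> y))
        = pmf P a * log b (1 / ?\<pi> a)"
      by simp
  qed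
  also have "\<dots> = measure_pmf.prob P A * shannon_entropy b (cond_pmf P A)"
    by (rule prob_mult_entropy_cond_pmf[OF b ne, symmetric])
  finally show ?thesis .
qed

section \<open>Closure distortion and the deletion procedure\<close>

lemma d_Cn_nonneg: "d_Cn Cn S s s' \<ge> 0"
  by (auto simp: d_Cn_def Let_def divide_le_eq_1 card_gt_0_iff intro!: card_mono)

lemma d_Cn_eq_0: "Cn ((S - {s}) \<union> {s'}) = Cn S \<Longrightarrow> d_Cn Cn S s s' = 0"
  by (auto simp: d_Cn_def Let_def)

context consequence_operator
begin

text \<open>All of \<open>B\<close> is derivable from \<open>B - {s}\<close>, so idempotence gives
  the nontrivial inclusion. This is the invariance of the closure under one deletion.\<close>

lemma Cn_Diff_derivable:
  assumes "s \<in> Cn (B - {s})"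
  shows "Cn (B - {s}) = Cn B"
proof
  show "Cn (B - {s}) \<subseteq> Cn B" by (rule Cn_mono) auto
  have "B \<subseteq> Cn (B - {s})" using assms Cn_refl[of "B - {s}"] by auto
  then show "Cn B \<subseteq> Cn (B - {s})" using Cn_mono Cn_idem by metis
qed

lemma Atom_subset: "Atom Cn S \<subseteq> set S"
  and Cn_Atom: "Cn (Atom Cn S) = Cn (set S)"
proof -
  let ?step = "\<lambda>s B. if s \<in> Cn (B - {s}) then B - {s} else B"
  \<comment> \<open>The scanned list and the current base are decoupled: the procedure starts from
    the set of the whole list, which the induction on the list would not keep fixed.\<close>
  have "fold ?step xs B \<subseteq> B \<and> Cn (fold ?step xs B) = Cn B" for xs B
  proof (induction xs arbitrary: B)
    case (Cons x xs)
    show ?case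
      using Cons.IH[of "?step x B"] Cn_Diff_derivable[of x B] by (auto split: if_splits)
  qed simp
  then show "Atom Cn S \<subseteq> set S" "Cn (Atom Cn S) = Cn (set S)" by (simp_all add: Atom_def)
qed

lemma d_Cn_refl: "s \<in> S \<Longrightarrow> d_Cn Cn S s s = 0"
  by (rule d_Cn_eq_0) (simp add: insert_absorb)

text \<open>The modified base still contains the core and stays inside the knowledge base. These two
  have equal closures, so the closure in between is the same.\<close>

lemma d_Cn_redundant:
  assumes "s \<notin> Atom Cn S" "a \<in> Atom Cn S"
  shows "d_Cn Cn (set S) s a = 0"
proof (rule d_Cn_eq_0)
  have sub: "(set S - {s}) \<union> {a} \<subseteq> set S" using assms Atom_subset by auto
  have sup: "Atom Cn S \<subseteq> (set S - {s}) \<union> {a}" using assms Atom_subset[of S] by auto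
  show "Cn ((set S - {s}) \<union> {a}) = Cn (set S)"
    using Cn_mono[OF sub] Cn_mono[OF sup] by (simp add: Cn_Atom)
qed

end

section \<open>Zero-distortion channels and the minimum\<close>

lemma feasible_channels_0_iff:
  fixes P :: "'a::finite pmf" and W :: "'a \<Rightarrow> 'b::finite pmf"
  assumes nonneg: "\<And>s y. d s y \<ge> 0"
  shows "W \<in> feasible_channels d P S S' 0 \<longleftrightarrow>
    W \<in> test_channels S S' \<and> (\<forall>s\<in>set_pmf P. \<forall>y\<in>set_pmf (W s). d s y = 0)"
proof -
  let ?J = "joint_pmf P W"
  have int: "integrable (measure_pmf ?J) (\<lambda>(s, y). d s y)"
    by (rule integrable_measure_pmf_finite) simp
  have "measure_pmf.expectation ?J (\<lambda>(s, y). d s y) \<ge> 0"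
    by (rule integral_nonneg_AE) (auto simp: nonneg)
  then have "measure_pmf.expectation ?J (\<lambda>(s, y). d s y) \<le> 0
      \<longleftrightarrow> measure_pmf.expectation ?J (\<lambda>(s, y). d s y) = 0"
    by linarith
  \<comment> \<open>A nonnegative function with mean zero vanishes almost surely, which turns the
    averaged constraint into one on supports.\<close>
  also have "\<dots> \<longleftrightarrow> (AE x in measure_pmf ?J. (case x of (s, y) \<Rightarrow> d s y) = 0)"
    by (rule integral_nonneg_eq_0_iff_AE[OF int]) (auto simp: nonneg)
  also have "\<dots> \<longleftrightarrow> (\<forall>s\<in>set_pmf P. \<forall>y\<in>set_pmf (W s). d s y = 0)"
    by (auto simp: AE_measure_pmf_iff joint_pmf_def)
  finally show ?thesis by (auto simp: feasible_channels_def)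
qed

lemma R_sem_eqI:
  assumes "W \<in> feasible_channels d P S S' D" "channel_information b P W = r"
    and "\<And>V. V \<in> feasible_channels d P S S' D \<Longrightarrow> r \<le> channel_information b P V"
  shows "R_sem b d P S S' D = ereal r"
proof -
  have "(LEAST x. x \<in> channel_information b P ` feasible_channels d P S S' D) = r"
    using assms by (intro Least_equality) auto
  then show ?thesis using assms(1) by (auto simp: R_sem_def)
qed

theorem mainTheorem1:
  fixes Cn :: "'a::finite set \<Rightarrow> 'a set"
    and S_O :: "'a list"
    and P_O :: "'a pmf"
    and S_hat :: "'a set"
    and b :: real
  defines "A \<equiv> Atom Cn S_O"
  defines "P_A \<equiv> measure_pmf.prob P_O A"
  assumes "consequence_operator Cn"
    and "deductive_source S_O P_O"
    and "S_hat \<noteq> {}"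
    and "b > 1"
    and "A \<noteq> {}"
    and "A \<subseteq> S_hat"
    and "\<And>a1 a2. a1 \<in> A \<Longrightarrow> a2 \<in> A \<Longrightarrow> a1 \<noteq> a2 \<Longrightarrow>
           R_Cn Cn (set S_O) S_hat a1 \<inter> R_Cn Cn (set S_O) S_hat a2 = {}"
  shows "R_sem b (d_Cn Cn (set S_O)) P_O (set S_O) S_hat 0 =
           ereal (if P_A = 0 then 0 else P_A * shannon_entropy b (cond_pmf P_O A))"
proof -
  interpret consequence_operator Cn by fact
  let ?d = "d_Cn Cn (set S_O)"
  note feasible_iff = feasible_channels_0_iff[of ?d, OF d_Cn_nonneg]
  have A_sub: "A \<subseteq> set S_O" unfolding A_def by (rule Atom_subset)
  have redundant: "?d s a = 0" if "s \<notin> A" "a \<in> A" for s a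
    using d_Cn_redundant that unfolding A_def .
  show ?thesis
  proof (cases "P_A = 0")
    case True
    \<comment> \<open>The source almost surely emits non-core statements, and all of these may be
      sent to one fixed core element; this constant channel conveys no information.\<close>
    obtain a where a: "a \<in> A" using \<open>A \<noteq> {}\<close> by blast
    have off: "s \<notin> A" if "s \<in> set_pmf P_O" for s
      using True that by (auto simp: P_A_def measure_pmf_zero_iff)
    have "R_sem b ?d P_O (set S_O) S_hat 0 = ereal 0"
    proof (rule R_sem_eqI)
      show "(\<lambda>_. return_pmf a) \<in> feasible_channels ?d P_O (set S_O) S_hat 0"
        unfolding feasible_iff using a \<open>A \<subseteq> S_hat\<close> off redundant by (auto simp: test_channels_def)
    qed (use \<open>b > 1\<close> in \<open>simp_all add: channel_information_const channel_information_nonneg\<close>)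
    then show ?thesis using True by simp
  next
    case False
    then have ne: "set_pmf P_O \<inter> A \<noteq> {}" by (auto simp: P_A_def measure_pmf_zero_iff)
    have "R_sem b ?d P_O (set S_O) S_hat 0 = ereal (P_A * shannon_entropy b (cond_pmf P_O A))"
    proof (rule R_sem_eqI)
      have set_core: "set_pmf (core_channel P_O A s) \<subseteq> A" for s
        using set_cond_pmf[OF ne] by (auto simp: core_channel_def)
      \<comment> \<open>A core statement is reproduced exactly; any other is replaced by a core
        element, which leaves the closure unchanged.\<close>
      have "?d s y = 0" if "y \<in> set_pmf (core_channel P_O A s)" for s y
        using that set_core[of s] redundant A_sub d_Cn_refl[of s "set S_O"]
        by (cases "s \<in> A") (auto simp: core_channel_def)
      then show "core_channel P_O A \<in> feasible_channels ?d P_O (set S_O) S_hat 0"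
        unfolding feasible_iff test_channels_def using set_core \<open>A \<subseteq> S_hat\<close> by blast
      show "channel_information b P_O (core_channel P_O A) = P_A * shannon_entropy b (cond_pmf P_O A)"
        unfolding P_A_def by (rule channel_information_core_channel[OF \<open>b > 1\<close> ne])
    next
      fix V assume V: "V \<in> feasible_channels ?d P_O (set S_O) S_hat 0"
      show "P_A * shannon_entropy b (cond_pmf P_O A) \<le> channel_information b P_O V"
        unfolding P_A_def
      proof (rule channel_information_ge_core_entropy[OF \<open>b > 1\<close> ne])
        show "disjoint_family_on (R_Cn Cn (set S_O) S_hat) A"
          using assms(9) by (auto simp: disjoint_family_on_def)
        \<comment> \<open>Zero mean distortion confines each core letter of positive probability to
          its own cell.\<close>
        show "set_pmf (V a) \<subseteq> R_Cn Cn (set S_O) S_hat a" if "a \<in> set_pmf P_O \<inter> A" for a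
          using V that A_sub unfolding feasible_iff by (auto simp: R_Cn_def test_channels_def)
      qed
    qed
    then show ?thesis using False by simp
  qed
qed

end
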